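(* Consider a two-player zero-sum finite game. In all full dual reductions, for every player, all pure strategies with positive marginal probability in at least one correlated equilibrium are grouped together and all other pure strategies are eliminated.
   Context: The game is $\Gamma=(\{1,2\},(C_1,C_2),(U_1,U_2))$ with $C_1,C_2$ finite nonempty, $C=C_1\times C_2$, and $U_1+U_2=0$; utilities are extended multilinearly to mixed strategies, and $c_{-i}$ denotes the strategy of the opponent of $i$. A correlated equilibrium is $\mu\in\Delta(C)$ with $\sum_{c_{-i}}\mu(c)[U_i(c_{-i},d_i)-U_i(c)]\le 0$ for all $i$ and $c_i,d_i\in C_i$ (where $c=(c_{-i},c_i)$). A deviation plan for player $i$ is a map $\alpha_i:C_i\to\Delta(C_i)$; write $\alpha_i\ast c_i$ for the image of $c_i$, $\alpha_i(d_i|c_i)=(\alpha_i\ast c_i)(d_i)$, and $\alpha_i\ast\sigma_i=\sum_{c_i}\sigma_i(c_i)(\alpha_i\ast c_i)$ for $\sigma_i\in\Delta(C_i)$. A dual vector is a profile of deviation plans $\alpha=(\alpha_1,\alpha_2)$ such that $\sum_{i}[U_i(c_{-i},\alpha_i\ast c_i)-U_i(c)]\ge 0$ for every $c\in C$. It is full if $\alpha_i(d_i|c_i)>0$ whenever $\beta_i(d_i|c_i)>0$ for some dual vector $\beta$. A nonempty $B_i\subset C_i$ is $\alpha_i$-absorbing if $\alpha_i\ast c_i$ has support in $B_i$ for every $c_i\in B_i$, and minimal $\alpha_i$-absorbing if moreover it has no nonempty proper absorbing subset. For each minimal $\alpha_i$-absorbing set there is a unique $\alpha_i$-stationary mixed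 strategy ($\alpha_i\ast\sigma_i=\sigma_i$) supported in it; $C_i/\alpha_i\subset\Delta(C_i)$ is the set of these strategies. $\Gamma/\alpha$ is the game with pure strategy sets $C_i/\alpha_i$ and the same utility functions; it is a full dual reduction if $\alpha$ is a full dual vector. In $\Gamma/\alpha$, a pure strategy $c_i$ is eliminated if $\sigma_i(c_i)=0$ for all $\sigma_i\in C_i/\alpha_i$; a set of pure strategies of player $i$ is grouped together if all its elements belong to one and the same minimal $\alpha_i$-absorbing set, i.e. all lie in the support of one and the same element of $C_i/\alpha_i$ (if the set is a singleton, this just means that the strategy is not eliminated). *)

theory Defs
  imports "HOL-Probability.Probability"
begin

text \<open>
  Mixed strategies and correlated distributions are probability mass functions whose
  support lies in the relevant finite strategy set.  The two players may have strategies
  of different types, so player-specific notions are written out for each player.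
\<close>

record ('a, 'b) game =
  strat1 :: "'a set"
  strat2 :: "'b set"
  util1 :: "'a \<Rightarrow> 'b \<Rightarrow> real"
  util2 :: "'a \<Rightarrow> 'b \<Rightarrow> real"

definition finite_game :: "('a, 'b) game \<Rightarrow> bool" where
  "finite_game G \<longleftrightarrow>
     finite (strat1 G) \<and> strat1 G \<noteq> {} \<and> finite (strat2 G) \<and> strat2 G \<noteq> {}"

definition zero_sum :: "('a, 'b) game \<Rightarrow> bool" where
  "zero_sum G \<longleftrightarrow> (\<forall>c1\<in>strat1 G. \<forall>c2\<in>strat2 G. util1 G c1 c2 + util2 G c1 c2 = 0)"

definition mixed_util :: "('a \<Rightarrow> 'b \<Rightarrow> real) \<Rightarrow> 'a pmf \<Rightarrow> 'b pmf \<Rightarrow> real" where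
  "mixed_util u \<sigma>1 \<sigma>2 = measure_pmf.expectation (pair_pmf \<sigma>1 \<sigma>2) (\<lambda>(c1, c2). u c1 c2)"

definition correlated_equilibrium :: "('a, 'b) game \<Rightarrow> ('a \<times> 'b) pmf \<Rightarrow> bool" where
  "correlated_equilibrium G \<mu> \<longleftrightarrow>
     set_pmf \<mu> \<subseteq> strat1 G \<times> strat2 G \<and>
     (\<forall>c1\<in>strat1 G. \<forall>d1\<in>strat1 G.
        (\<Sum>c2\<in>strat2 G. pmf \<mu> (c1, c2) * (util1 G d1 c2 - util1 G c1 c2)) \<le> 0) \<and>
     (\<forall>c2\<in>strat2 G. \<forall>d2\<in>strat2 G.
        (\<Sum>c1\<in>strat1 G. pmf \<mu> (c1, c2) * (util2 G c1 d2 - util2 G c1 c2)) \<le> 0)"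

text \<open>
  A deviation plan is used only through its values on \<open>C\<close>.  The probability of \<open>d\<close> given
  \<open>c\<close> is \<open>pmf (\<alpha> c) d\<close>, and the image of a mixed strategy \<open>\<sigma>\<close> is \<open>bind_pmf \<sigma> \<alpha>\<close>.
\<close>

definition deviation_plan :: "'a set \<Rightarrow> ('a \<Rightarrow> 'a pmf) \<Rightarrow> bool" where
  "deviation_plan C \<alpha> \<longleftrightarrow> (\<forall>c\<in>C. set_pmf (\<alpha> c) \<subseteq> C)"

definition dual_vector ::
    "('a, 'b) game \<Rightarrow> ('a \<Rightarrow> 'a pmf) \<Rightarrow> ('b \<Rightarrow> 'b pmf) \<Rightarrow> bool" where
  "dual_vector G \<alpha>1 \<alpha>2 \<longleftrightarrow>
     deviation_plan (strat1 G) \<alpha>1 \<and> deviation_plan (strat2 G) \<alpha>2 \<and>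
     (\<forall>c1\<in>strat1 G. \<forall>c2\<in>strat2 G.
        (mixed_util (util1 G) (\<alpha>1 c1) (return_pmf c2) - util1 G c1 c2) +
        (mixed_util (util2 G) (return_pmf c1) (\<alpha>2 c2) - util2 G c1 c2) \<ge> 0)"

definition full_dual_vector ::
    "('a, 'b) game \<Rightarrow> ('a \<Rightarrow> 'a pmf) \<Rightarrow> ('b \<Rightarrow> 'b pmf) \<Rightarrow> bool" where
  "full_dual_vector G \<alpha>1 \<alpha>2 \<longleftrightarrow>
     dual_vector G \<alpha>1 \<alpha>2 \<and>
     (\<forall>\<beta>1 \<beta>2. dual_vector G \<beta>1 \<beta>2 \<longrightarrow>
        (\<forall>c\<in>strat1 G. \<forall>d\<in>strat1 G. pmf (\<beta>1 c) d > 0 \<longrightarrow> pmf (\<alpha>1 c) d > 0) \<and>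
        (\<forall>c\<in>strat2 G. \<forall>d\<in>strat2 G. pmf (\<beta>2 c) d > 0 \<longrightarrow> pmf (\<alpha>2 c) d > 0))"

definition absorbing :: "'a set \<Rightarrow> ('a \<Rightarrow> 'a pmf) \<Rightarrow> 'a set \<Rightarrow> bool" where
  "absorbing C \<alpha> B \<longleftrightarrow> B \<noteq> {} \<and> B \<subseteq> C \<and> (\<forall>c\<in>B. set_pmf (\<alpha> c) \<subseteq> B)"

definition minimal_absorbing :: "'a set \<Rightarrow> ('a \<Rightarrow> 'a pmf) \<Rightarrow> 'a set \<Rightarrow> bool" where
  "minimal_absorbing C \<alpha> B \<longleftrightarrow>
     absorbing C \<alpha> B \<and> \<not> (\<exists>B'. B' \<subset> B \<and> absorbing C \<alpha> B')"

definition stationary :: "('a \<Rightarrow> 'a pmf) \<Rightarrow> 'a pmf \<Rightarrow> bool" where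
  "stationary \<alpha> \<sigma> \<longleftrightarrow> bind_pmf \<sigma> \<alpha> = \<sigma>"

definition reduced_strategies :: "'a set \<Rightarrow> ('a \<Rightarrow> 'a pmf) \<Rightarrow> 'a pmf set" where
  "reduced_strategies C \<alpha> =
     {\<sigma>. stationary \<alpha> \<sigma> \<and> (\<exists>B. minimal_absorbing C \<alpha> B \<and> set_pmf \<sigma> \<subseteq> B)}"

definition dual_reduction ::
    "('a, 'b) game \<Rightarrow> ('a \<Rightarrow> 'a pmf) \<Rightarrow> ('b \<Rightarrow> 'b pmf) \<Rightarrow> ('a pmf, 'b pmf) game" where
  "dual_reduction G \<alpha>1 \<alpha>2 =
     \<lparr>strat1 = reduced_strategies (strat1 G) \<alpha>1,
      strat2 = reduced_strategies (strat2 G) \<alpha>2,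
      util1 = mixed_util (util1 G),
      util2 = mixed_util (util2 G)\<rparr>"

text \<open>In \<open>eliminated\<close>, \<open>R\<close> is a player's pure strategy set in the reduced game.\<close>

definition eliminated :: "'a pmf set \<Rightarrow> 'a \<Rightarrow> bool" where
  "eliminated R c \<longleftrightarrow> (\<forall>\<sigma>\<in>R. pmf \<sigma> c = 0)"

definition grouped_together :: "'a set \<Rightarrow> ('a \<Rightarrow> 'a pmf) \<Rightarrow> 'a set \<Rightarrow> bool" where
  "grouped_together C \<alpha> S \<longleftrightarrow> (\<exists>B. minimal_absorbing C \<alpha> B \<and> S \<subseteq> B)"

definition ce_strategies1 :: "('a, 'b) game \<Rightarrow> 'a set" where
  "ce_strategies1 G =
     {c \<in> strat1 G. \<exists>\<mu>. correlated_equilibrium G \<mu> \<and> pmf (map_pmf fst \<mu>) c > 0}"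

definition ce_strategies2 :: "('a, 'b) game \<Rightarrow> 'b set" where
  "ce_strategies2 G =
     {c \<in> strat2 G. \<exists>\<mu>. correlated_equilibrium G \<mu> \<and> pmf (map_pmf snd \<mu>) c > 0}"

end

theory Submission
  imports Defs
begin

text \<open>
  Let \<open>v\<close> be the value of the game and call a mixed strategy of player 1 optimal if it secures
  \<open>v\<close> against every pure reply.  Let \<open>S\<close> be the union of the supports of the optimal strategies.

  The set \<open>S\<close> consists exactly of the strategies played in some correlated equilibrium
  (\<open>ce_strategies1_eq\<close>): marginals of correlated equilibria are optimal
  (\<open>ce_marginal_secures\<close>), and products of optimal strategies are Nash equilibria
  (\<open>optimal_product_ce\<close>).

  In a zero-sum game a profile of deviation plans is a dual vector exactly when
  \<open>U1(\<alpha>1 * c1, c2) \<ge> U1(c1, \<alpha>2 * c2)\<close> for all \<open>c1, c2\<close>.  This has two consequences.  Sending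
  every pure strategy of a player to one fixed optimal strategy gives a dual vector
  (\<open>constant_dual_vector\<close>); hence a full dual vector moves every strategy onto all of \<open>S\<close> with
  positive probability, and every absorbing set contains \<open>S\<close>.  Conversely, if \<open>p\<close> is optimal then
  \<open>U1(\<alpha>1 * p, c2) \<ge> U1(p, \<alpha>2 * c2) \<ge> v\<close>, so every dual vector maps optimal strategies to optimal
  ones (\<open>secures_bind_dual\<close>) and \<open>S\<close> itself is absorbing.  Therefore \<open>S\<close> is the only minimal
  absorbing set.  Its elements are grouped together, and everything outside it is eliminated.

  The claim for player 2 is the claim for player 1 in the game with the players exchanged.  That
  \<open>S\<close> is nonempty is the minimax theorem, which is proved here from compactness of the simplex by
  minimising the sum of squared shortfalls.
\<close>

section \<open>The minimax theorem for matrices\<close>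

text \<open>
  The value outside \<open>A\<close> is pinned to 0 so that the simplex is a compact subset of the full
  function space, whatever the type of the indices.
\<close>

definition weights :: "'a set \<Rightarrow> ('a \<Rightarrow> real) set" where
  "weights A = {x. (\<forall>i. 0 \<le> x i) \<and> (\<forall>i. i \<notin> A \<longrightarrow> x i = 0) \<and> sum x A = 1}"

lemma point_weights: "finite A \<Longrightarrow> i \<in> A \<Longrightarrow> (\<lambda>k. if k = i then 1 else 0) \<in> weights A"
  by (auto simp: weights_def)

lemma weights_nonempty: "finite A \<Longrightarrow> A \<noteq> {} \<Longrightarrow> weights A \<noteq> {}"
  using point_weights by (metis empty_iff ex_in_conv)

lemma weights_convex:
  assumes "x \<in> weights A" "y \<in> weights A" "0 \<le> t" "t \<le> 1"
  shows "(\<lambda>i. (1 - t) * x i + t * y i) \<in> weights A"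
  using assms by (auto simp: weights_def sum.distrib simp flip: sum_distrib_left)

text \<open>
  The simplex is closed in the product of the intervals \<open>[0, 1]\<close>, which is compact by Tychonoff.
\<close>

lemma compact_weights:
  assumes "finite A"
  shows "compact (weights A)"
proof -
  have "compactin (product_topology (\<lambda>i::'a. euclidean) UNIV) (PiE UNIV (\<lambda>i. {0..1::real}))"
    by (auto simp: compactin_PiE)
  then have box: "compact (PiE UNIV (\<lambda>i::'a. {0..1::real}))"
    by (simp add: euclidean_product_topology)
  have "closed ({x::'a \<Rightarrow> real. (\<forall>i. 0 \<le> x i)} \<inter> {x. \<forall>i. i \<in> - A \<longrightarrow> x i = 0} \<inter> {x. sum x A = 1})"
    by (intro closed_Int closed_Collect_all closed_Collect_imp closed_Collect_le closed_Collect_eq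
        continuous_intros continuous_on_product_coordinates) auto
  also have "\<dots> = weights A"
    by (auto simp: weights_def)
  finally have "closed (weights A)" .
  moreover have "weights A \<subseteq> PiE UNIV (\<lambda>i. {0..1})"
  proof
    fix x assume x: "x \<in> weights A"
    have "x i \<le> 1" for i
    proof (cases "i \<in> A")
      case True
      then have "x i \<le> sum x A"
        using x assms by (intro member_le_sum) (auto simp: weights_def)
      with x show ?thesis by (simp add: weights_def)
    qed (use x in \<open>auto simp: weights_def\<close>)
    with x show "x \<in> PiE UNIV (\<lambda>i. {0..1})"
      by (auto simp: weights_def)
  qed
  ultimately show ?thesis
    using box compact_Int_closed by (metis inf.absorb_iff2)
qed

lemma continuous_on_coordinate: "continuous_on S (\<lambda>x::'a \<Rightarrow> real. x i)"
  by (rule continuous_on_subset[OF continuous_on_product_coordinates]) simp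

lemma continuous_on_Max_image:
  fixes f :: "'i \<Rightarrow> 'a::topological_space \<Rightarrow> real"
  assumes "finite I" "I \<noteq> {}" "\<And>i. i \<in> I \<Longrightarrow> continuous_on S (f i)"
  shows "continuous_on S (\<lambda>x. Max ((\<lambda>i. f i x) ` I))"
  using assms by (induction rule: finite_ne_induct) (auto intro!: continuous_intros)

text \<open>
  Minimise the sum over \<open>j\<close> of the squared shortfalls \<open>max 0 (- (x a)\<^sub>j)\<close> over the simplex.  If the
  minimum is 0, the minimiser satisfies the first alternative.  Otherwise the vector \<open>y\<close> of
  shortfalls at the minimiser, normalised, satisfies the second: since moving \<open>x\<close> towards any
  vertex \<open>i\<close> cannot decrease the objective, \<open>(a y)\<^sub>i \<le> \<Sum>j. y\<^sub>j (x a)\<^sub>j = - \<Sum>j. y\<^sub>j\<^sup>2 < 0\<close>.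
\<close>

lemma matrix_alternative:
  fixes a :: "'a \<Rightarrow> 'b \<Rightarrow> real"
  assumes A: "finite A" "A \<noteq> {}" and B: "finite B"
  shows "(\<exists>x \<in> weights A. \<forall>j\<in>B. 0 \<le> (\<Sum>i\<in>A. x i * a i j)) \<or>
         (\<exists>y \<in> weights B. \<forall>i\<in>A. (\<Sum>j\<in>B. y j * a i j) < 0)"
proof -
  define g where "g x j = (\<Sum>i\<in>A. x i * a i j)" for x j
  define f where "f x = (\<Sum>j\<in>B. (max 0 (- g x j))\<^sup>2)" for x
  have "continuous_on (weights A) f"
    unfolding f_def g_def
    by (intro continuous_intros continuous_on_coordinate)
  then obtain x where x: "x \<in> weights A" and min: "\<And>z. z \<in> weights A \<Longrightarrow> f x \<le> f z"
    using continuous_attains_inf[OF compact_weights[OF A(1)] weights_nonempty[OF A]] by blast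
  define y where "y j = max 0 (- g x j)" for j
  show ?thesis
  proof (cases "\<forall>j\<in>B. y j = 0")
    case True
    then have "\<forall>j\<in>B. 0 \<le> g x j"
      by (force simp: y_def max_def split: if_splits)
    with x show ?thesis unfolding g_def by blast
  next
    case False
    have ynn: "0 \<le> y j" for j by (simp add: y_def)
    have pos: "0 < sum y B" "0 < (\<Sum>j\<in>B. (y j)\<^sup>2)"
      using False B ynn by (auto simp: sum_nonneg_eq_0_iff sum_nonneg order_less_le)
    have neg: "(\<Sum>j\<in>B. y j * a i j) < 0" if i: "i \<in> A" for i
    proof -
      define d where "d j = a i j - g x j" for j
      define s where "s = (\<Sum>j\<in>B. y j * d j)"
      define K where "K = (\<Sum>j\<in>B. (d j)\<^sup>2)"
      \<comment> \<open>The objective on the segment from \<open>x\<close> to the vertex \<open>i\<close> is bounded by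
          \<open>f x - 2 t s + t\<^sup>2 K\<close>, so minimality of \<open>x\<close> bounds \<open>s\<close>; small \<open>t\<close> then excludes \<open>s > 0\<close>.\<close>
      have quad: "2 * s \<le> t * K" if t: "0 < t" "t \<le> 1" for t
      proof -
        let ?z = "\<lambda>k. (1 - t) * x k + t * (if k = i then 1 else 0)"
        have gz: "g ?z j = g x j + t * d j" for j
        proof -
          have "(\<Sum>k\<in>A. (if k = i then 1 else 0) * a k j) = a i j"
            using i A by (simp add: mult_delta_left)
          then have "g ?z j = (1 - t) * g x j + t * a i j"
            unfolding g_def by (simp add: distrib_right sum.distrib mult.assoc flip: sum_distrib_left)
          then show ?thesis by (simp add: d_def algebra_simps)
        qed
        have "?z \<in> weights A"
          using weights_convex[OF x point_weights] i A t by simp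
        then have "f x \<le> f ?z" by (rule min)
        also have "\<dots> \<le> (\<Sum>j\<in>B. (y j - t * d j)\<^sup>2)"
          unfolding f_def gz
        proof (intro sum_mono)
          fix j
          have "max 0 (- (g x j + t * d j)) \<le> \<bar>y j - t * d j\<bar>"
            by (auto simp: y_def)
          then show "(max 0 (- (g x j + t * d j)))\<^sup>2 \<le> (y j - t * d j)\<^sup>2"
            by (metis abs_ge_zero abs_le_square_iff abs_of_nonneg max.cobounded1)
        qed
        also have "\<dots> = f x - 2 * t * s + t\<^sup>2 * K"
          by (simp add: f_def s_def K_def y_def power2_diff sum.distrib sum_subtractf
              power_mult_distrib sum_distrib_left mult_ac)
        finally have "t * (2 * s) \<le> t * (t * K)"
          by (simp add: power2_eq_square mult_ac)
        with t show ?thesis by simp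
      qed
      have "s \<le> 0"
      proof (rule ccontr)
        assume "\<not> s \<le> 0"
        then have s: "0 < s" by simp
        with quad[of 1] have K: "0 < K" by simp
        have "2 * s \<le> min 1 (s / K) * K"
          using s K by (intro quad) auto
        also have "\<dots> \<le> s / K * K" using K by (intro mult_right_mono) auto
        finally show False using s K by simp
      qed
      moreover have "y j * g x j = - (y j)\<^sup>2" for j
        by (auto simp: y_def max_def power2_eq_square)
      ultimately have "(\<Sum>j\<in>B. y j * a i j) \<le> - (\<Sum>j\<in>B. (y j)\<^sup>2)"
        by (simp add: s_def d_def right_diff_distrib sum_subtractf sum.distrib sum_negf)
      with pos show ?thesis by simp
    qed
    define w where "w j = (if j \<in> B then y j / sum y B else 0)" for j
    have "w \<in> weights B"
      using pos ynn by (auto simp: weights_def w_def simp flip: sum_divide_distrib)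
    moreover have "(\<Sum>j\<in>B. w j * a i j) < 0" if "i \<in> A" for i
    proof -
      have "(\<Sum>j\<in>B. w j * a i j) = (\<Sum>j\<in>B. y j * a i j) / sum y B"
        by (simp add: w_def sum_divide_distrib)
      with neg[OF that] pos show ?thesis by (simp add: divide_neg_pos)
    qed
    ultimately show ?thesis by blast
  qed
qed

text \<open>
  Take \<open>y\<close> to minimise the maximal row payoff \<open>h y\<close>.  After subtracting \<open>h y\<close> from the matrix, the
  second case of the alternative would produce a column mixture with a smaller maximum; so the
  first case holds and gives a row mixture securing \<open>h y\<close>.
\<close>

lemma matrix_minimax:
  fixes a :: "'a \<Rightarrow> 'b \<Rightarrow> real"
  assumes A: "finite A" "A \<noteq> {}" and B: "finite B" "B \<noteq> {}"
  obtains v x y where "x \<in> weights A" "y \<in> weights B"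
    "\<And>j. j \<in> B \<Longrightarrow> v \<le> (\<Sum>i\<in>A. x i * a i j)" "\<And>i. i \<in> A \<Longrightarrow> (\<Sum>j\<in>B. y j * a i j) \<le> v"
proof -
  define h where "h y = Max ((\<lambda>i. \<Sum>j\<in>B. y j * a i j) ` A)" for y
  have h_ge: "(\<Sum>j\<in>B. y j * a i j) \<le> h y" if "i \<in> A" for i y
    using that A by (auto simp: h_def)
  have "continuous_on (weights B) h"
    unfolding h_def using A
    by (intro continuous_on_Max_image continuous_intros continuous_on_coordinate)
  then obtain y where y: "y \<in> weights B" and min: "\<And>z. z \<in> weights B \<Longrightarrow> h y \<le> h z"
    using continuous_attains_inf[OF compact_weights[OF B(1)] weights_nonempty[OF B]] by blast
  have shift: "(\<Sum>j\<in>B. z j * (a i j - h y)) = (\<Sum>j\<in>B. z j * a i j) - h y"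
    if "z \<in> weights B" for z i
    using that by (simp add: weights_def right_diff_distrib sum_subtractf flip: sum_distrib_right)
  have no: "\<not> (\<exists>z \<in> weights B. \<forall>i\<in>A. (\<Sum>j\<in>B. z j * (a i j - h y)) < 0)"
  proof
    assume "\<exists>z \<in> weights B. \<forall>i\<in>A. (\<Sum>j\<in>B. z j * (a i j - h y)) < 0"
    then obtain z where z: "z \<in> weights B" "\<And>i. i \<in> A \<Longrightarrow> (\<Sum>j\<in>B. z j * a i j) < h y"
      using shift by auto
    then have "h z < h y"
      using A by (simp add: h_def)
    with min[OF z(1)] show False by simp
  qed
  obtain x where x: "x \<in> weights A" "\<And>j. j \<in> B \<Longrightarrow> 0 \<le> (\<Sum>i\<in>A. x i * (a i j - h y))"
    using matrix_alternative[OF A B(1), of "\<lambda>i j. a i j - h y"] no by blast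
  have x_ge: "h y \<le> (\<Sum>i\<in>A. x i * a i j)" if "j \<in> B" for j
    using x(2)[OF that] x(1)
    by (simp add: weights_def right_diff_distrib sum_subtractf flip: sum_distrib_right)
  show thesis by (rule that[OF x(1) y x_ge h_ge])
qed

section \<open>Expected utilities as finite sums\<close>

lemma pmf_of_weights:
  assumes "finite A" "x \<in> weights A"
  obtains p where "set_pmf p \<subseteq> A" "pmf p = x"
proof -
  have nn: "\<And>i. 0 \<le> x i" and supp: "\<And>i. i \<notin> A \<Longrightarrow> x i = 0" and one: "sum x A = 1"
    using assms by (auto simp: weights_def)
  have "(\<integral>\<^sup>+i. ennreal (x i) \<partial>count_space UNIV) = (\<Sum>i\<in>A. ennreal (x i))"
    using assms(1) supp by (intro nn_integral_count_space') auto
  also have "\<dots> = 1"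
    using nn one by (simp add: sum_ennreal)
  finally have int: "(\<integral>\<^sup>+i. ennreal (x i) \<partial>count_space UNIV) = 1" .
  show thesis
    by (rule that[of "embed_pmf x"]) (use nn int supp in \<open>auto simp: set_embed_pmf pmf_embed_pmf\<close>)
qed


lemma mixed_util_return_right:
  "mixed_util u p (return_pmf j) = measure_pmf.expectation p (\<lambda>i. u i j)"
  by (simp add: mixed_util_def pair_return_pmf2)

lemma mixed_util_return_left:
  "mixed_util u (return_pmf i) q = measure_pmf.expectation q (u i)"
  by (simp add: mixed_util_def pair_return_pmf1)

lemma expectation_pmf_sum:
  fixes f :: "'a \<Rightarrow> real"
  assumes "finite A" "set_pmf p \<subseteq> A"
  shows "measure_pmf.expectation p f = (\<Sum>i\<in>A. pmf p i * f i)"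
  using assms by (subst integral_measure_pmf[of A]) auto

lemma pmf_map_fst:
  assumes "finite B" "set_pmf \<mu> \<subseteq> A \<times> B"
  shows "pmf (map_pmf fst \<mu>) i = (\<Sum>j\<in>B. pmf \<mu> (i, j))"
proof -
  have "pmf (map_pmf fst \<mu>) i = measure_pmf.prob \<mu> (Pair i ` B)"
    unfolding pmf_map using assms(2) by (intro measure_prob_cong_0) (auto simp: set_pmf_iff)
  also have "\<dots> = (\<Sum>j\<in>B. pmf \<mu> (i, j))"
    using assms(1) by (simp add: measure_measure_pmf_finite sum.reindex inj_on_def)
  finally show ?thesis .
qed

section \<open>Exchanging the players\<close>

lemma zero_sum_util2:
  "zero_sum G \<Longrightarrow> c1 \<in> strat1 G \<Longrightarrow> c2 \<in> strat2 G \<Longrightarrow> util2 G c1 c2 = - util1 G c1 c2"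
  by (simp add: zero_sum_def eq_neg_iff_add_eq_0 add.commute)

definition swap_game :: "('a, 'b) game \<Rightarrow> ('b, 'a) game" where
  "swap_game G = \<lparr>strat1 = strat2 G, strat2 = strat1 G,
     util1 = (\<lambda>c2 c1. util2 G c1 c2), util2 = (\<lambda>c2 c1. util1 G c1 c2)\<rparr>"

lemma swap_game_sel [simp]:
  "strat1 (swap_game G) = strat2 G" "strat2 (swap_game G) = strat1 G"
  "util1 (swap_game G) = (\<lambda>c2 c1. util2 G c1 c2)" "util2 (swap_game G) = (\<lambda>c2 c1. util1 G c1 c2)"
  by (simp_all add: swap_game_def)

lemma swap_swap_game [simp]: "swap_game (swap_game G) = G"
  by (simp add: swap_game_def)

lemma finite_game_swap [simp]: "finite_game (swap_game G) \<longleftrightarrow> finite_game G"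
  by (auto simp: finite_game_def)

lemma zero_sum_swap [simp]: "zero_sum (swap_game G) \<longleftrightarrow> zero_sum G"
  by (auto simp: zero_sum_def add.commute)

lemma dual_vector_swap: "dual_vector (swap_game G) \<alpha>2 \<alpha>1 \<longleftrightarrow> dual_vector G \<alpha>1 \<alpha>2"
  by (auto simp: dual_vector_def mixed_util_return_left mixed_util_return_right add.commute)

lemma full_dual_vector_swap: "full_dual_vector G \<alpha>1 \<alpha>2 \<Longrightarrow> full_dual_vector (swap_game G) \<alpha>2 \<alpha>1"
  by (simp add: full_dual_vector_def dual_vector_swap)

lemma correlated_equilibrium_swap:
  assumes "correlated_equilibrium G \<mu>"
  shows "correlated_equilibrium (swap_game G) (map_pmf prod.swap \<mu>)"
proof -
  have "pmf (map_pmf prod.swap \<mu>) (j, i) = pmf \<mu> (i, j)" for i j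
    using pmf_map_inj'[of prod.swap \<mu> "(i, j)"] by simp
  then show ?thesis
    using assms by (auto simp: correlated_equilibrium_def)
qed

lemma ce_strategies1_swap: "ce_strategies1 (swap_game G) = ce_strategies2 G"
proof -
  have snd_swap: "map_pmf fst (map_pmf prod.swap \<mu>) = map_pmf snd \<mu>" for \<mu> :: "('x \<times> 'y) pmf"
    by (simp add: pmf.map_comp o_def)
  have fst_swap: "map_pmf snd (map_pmf prod.swap \<mu>) = map_pmf fst \<mu>" for \<mu> :: "('x \<times> 'y) pmf"
    by (simp add: pmf.map_comp o_def)
  show ?thesis
    unfolding ce_strategies1_def ce_strategies2_def swap_game_sel
    using correlated_equilibrium_swap[of G] correlated_equilibrium_swap[of "swap_game G"]
    by (metis (no_types, opaque_lifting) snd_swap fst_swap swap_swap_game)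
qed

section \<open>Optimal strategies and correlated equilibria\<close>

definition secures :: "('a, 'b) game \<Rightarrow> real \<Rightarrow> 'a pmf \<Rightarrow> bool" where
  "secures G v p \<longleftrightarrow> set_pmf p \<subseteq> strat1 G \<and>
     (\<forall>c2\<in>strat2 G. v \<le> mixed_util (util1 G) p (return_pmf c2))"

lemma secures_iff:
  assumes "finite_game G"
  shows "secures G v p \<longleftrightarrow> set_pmf p \<subseteq> strat1 G \<and>
     (\<forall>c2\<in>strat2 G. v \<le> (\<Sum>c1\<in>strat1 G. pmf p c1 * util1 G c1 c2))"
proof -
  have "finite (strat1 G)"
    using assms by (simp add: finite_game_def)
  then show ?thesis
    unfolding secures_def mixed_util_return_right
    by (intro conj_cong refl ball_cong) (simp add: expectation_pmf_sum)
qed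

text \<open>
  For player 2 of a zero-sum game, securing \<open>- v\<close> means holding player 1 down to \<open>v\<close>.  A pair
  \<open>secures G v p\<close> and \<open>secures (swap_game G) (- v) q\<close> thus says that \<open>v\<close> is the value of the game
  and that \<open>p\<close> and \<open>q\<close> are optimal.
\<close>

lemma secures_swap_iff:
  assumes "finite_game G" "zero_sum G"
  shows "secures (swap_game G) (- v) q \<longleftrightarrow> set_pmf q \<subseteq> strat2 G \<and>
     (\<forall>c1\<in>strat1 G. (\<Sum>c2\<in>strat2 G. pmf q c2 * util1 G c1 c2) \<le> v)"
proof -
  have "(\<Sum>c2\<in>strat2 G. pmf q c2 * util2 G c1 c2) = - (\<Sum>c2\<in>strat2 G. pmf q c2 * util1 G c1 c2)"
    if "c1 \<in> strat1 G" for c1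
    unfolding sum_negf[symmetric] using assms(2) that
    by (intro sum.cong) (auto simp: zero_sum_util2)
  then show ?thesis
    using assms(1) by (auto simp: secures_iff)
qed

lemma game_value_exists:
  assumes "finite_game G" "zero_sum G"
  obtains v p q where "secures G v p" "secures (swap_game G) (- v) q"
proof -
  have fin: "finite (strat1 G)" "strat1 G \<noteq> {}" "finite (strat2 G)" "strat2 G \<noteq> {}"
    using assms(1) by (auto simp: finite_game_def)
  obtain v x y where x: "x \<in> weights (strat1 G)" and y: "y \<in> weights (strat2 G)"
    and xy: "\<And>c2. c2 \<in> strat2 G \<Longrightarrow> v \<le> (\<Sum>c1\<in>strat1 G. x c1 * util1 G c1 c2)"
      "\<And>c1. c1 \<in> strat1 G \<Longrightarrow> (\<Sum>c2\<in>strat2 G. y c2 * util1 G c1 c2) \<le> v"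
    by (rule matrix_minimax[OF fin, of "util1 G"]) blast
  obtain p where "set_pmf p \<subseteq> strat1 G" "pmf p = x"
    using pmf_of_weights[OF fin(1) x] .
  moreover obtain q where "set_pmf q \<subseteq> strat2 G" "pmf q = y"
    using pmf_of_weights[OF fin(3) y] .
  ultimately show thesis
    using xy by (intro that[of v p q]) (simp_all add: secures_iff[OF assms(1)] secures_swap_iff[OF assms])
qed

text \<open>
  Let \<open>E\<close> be the payoff of player 1 under \<open>\<mu>\<close>.  Adding up the incentive constraints of player 1 over
  all recommendations shows that no strategy earns more than \<open>E\<close> against the marginal of player 2;
  as \<open>p\<close> earns at least \<open>v\<close>, this gives \<open>v \<le> E\<close>.  Adding up those of player 2 shows that
  the marginal of player 1 earns at least \<open>E\<close> against every reply.
\<close>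

lemma ce_marginal_secures:
  assumes G: "finite_game G" "zero_sum G" and p: "secures G v p"
    and ce: "correlated_equilibrium G \<mu>"
  shows "secures G v (map_pmf fst \<mu>)"
proof -
  let ?A = "strat1 G" and ?B = "strat2 G" and ?u = "util1 G"
  have fin: "finite ?A" "finite ?B" and sub: "set_pmf \<mu> \<subseteq> ?A \<times> ?B"
    using G ce by (auto simp: finite_game_def correlated_equilibrium_def)
  have p_sub: "set_pmf p \<subseteq> ?A" and p_v: "\<And>j. j \<in> ?B \<Longrightarrow> v \<le> (\<Sum>i\<in>?A. pmf p i * ?u i j)"
    using p by (auto simp: secures_iff[OF G(1)])
  have p_sum: "(\<Sum>i\<in>?A. pmf p i) = 1"
    using fin p_sub by (simp add: sum_pmf_eq_1)
  define E where "E = (\<Sum>i\<in>?A. \<Sum>j\<in>?B. pmf \<mu> (i, j) * ?u i j)"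
  define m where "m j = (\<Sum>i\<in>?A. pmf \<mu> (i, j))" for j
  have m_sum: "sum m ?B = 1"
    unfolding m_def by (subst sum.swap) (use sub fin in \<open>simp add: sum.cartesian_product sum_pmf_eq_1\<close>)
  have dev1: "(\<Sum>j\<in>?B. m j * ?u d j) \<le> E" if d: "d \<in> ?A" for d
  proof -
    have "(\<Sum>i\<in>?A. \<Sum>j\<in>?B. pmf \<mu> (i, j) * (?u d j - ?u i j)) \<le> 0"
      using ce d by (intro sum_nonpos[of ?A]) (simp add: correlated_equilibrium_def)
    moreover have "(\<Sum>j\<in>?B. m j * ?u d j) = (\<Sum>i\<in>?A. \<Sum>j\<in>?B. pmf \<mu> (i, j) * ?u d j)"
      unfolding m_def sum_distrib_right by (rule sum.swap)
    ultimately show ?thesis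
      by (simp add: E_def right_diff_distrib sum_subtractf)
  qed
  have "v = (\<Sum>j\<in>?B. m j * v)"
    by (simp add: m_sum flip: sum_distrib_right)
  also have "\<dots> \<le> (\<Sum>j\<in>?B. m j * (\<Sum>i\<in>?A. pmf p i * ?u i j))"
    using p_v by (intro sum_mono mult_left_mono) (auto simp: m_def intro: sum_nonneg)
  also have "\<dots> = (\<Sum>i\<in>?A. pmf p i * (\<Sum>j\<in>?B. m j * ?u i j))"
    unfolding sum_distrib_left by (subst sum.swap) (simp add: mult_ac)
  also have "\<dots> \<le> (\<Sum>i\<in>?A. pmf p i * E)"
    using dev1 by (intro sum_mono mult_left_mono) auto
  also have "\<dots> = E"
    by (simp add: p_sum flip: sum_distrib_right)
  finally have v_le: "v \<le> E" .
  have dev2: "E \<le> (\<Sum>i\<in>?A. pmf (map_pmf fst \<mu>) i * ?u i d)" if d: "d \<in> ?B" for d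
  proof -
    have "(\<Sum>j\<in>?B. \<Sum>i\<in>?A. pmf \<mu> (i, j) * (?u i j - ?u i d))
        = (\<Sum>j\<in>?B. \<Sum>i\<in>?A. pmf \<mu> (i, j) * (util2 G i d - util2 G i j))"
      using G(2) d by (intro sum.cong refl arg_cong[where f="(*) _"])
        (auto simp: zero_sum_util2)
    also have "\<dots> \<le> 0"
      using ce d by (intro sum_nonpos[of ?B]) (simp add: correlated_equilibrium_def)
    finally have "(\<Sum>i\<in>?A. \<Sum>j\<in>?B. pmf \<mu> (i, j) * (?u i j - ?u i d)) \<le> 0"
      by (subst sum.swap)
    then show ?thesis
      by (simp add: E_def right_diff_distrib sum_subtractf sum_distrib_right pmf_map_fst[OF fin(2) sub])
  qed
  have "set_pmf (map_pmf fst \<mu>) \<subseteq> ?A"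
    using sub by auto
  moreover have "v \<le> (\<Sum>i\<in>?A. pmf (map_pmf fst \<mu>) i * ?u i d)" if "d \<in> ?B" for d
    using v_le dev2[OF that] by simp
  ultimately show ?thesis
    by (simp add: secures_iff[OF G(1)])
qed

text \<open>
  Every row earns at most \<open>v\<close> against \<open>q\<close>, while the average over \<open>p\<close> is at least \<open>v\<close>.  So every row
  in the support of \<open>p\<close> earns exactly \<open>v\<close>, and no deviation from it is profitable.
\<close>

lemma optimal_product_incentive:
  assumes G: "finite_game G" "zero_sum G"
    and p: "secures G v p" and q: "secures (swap_game G) (- v) q"
    and c: "c \<in> strat1 G" and d: "d \<in> strat1 G"
  shows "(\<Sum>j\<in>strat2 G. pmf (pair_pmf p q) (c, j) * (util1 G d j - util1 G c j)) \<le> 0"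
proof -
  let ?A = "strat1 G" and ?B = "strat2 G" and ?u = "util1 G"
  have fin: "finite ?A" "finite ?B"
    using G by (auto simp: finite_game_def)
  have p_sub: "set_pmf p \<subseteq> ?A" and p_v: "\<And>j. j \<in> ?B \<Longrightarrow> v \<le> (\<Sum>i\<in>?A. pmf p i * ?u i j)"
    using p by (auto simp: secures_iff[OF G(1)])
  define r where "r i = (\<Sum>j\<in>?B. pmf q j * ?u i j)" for i
  have q_sub: "set_pmf q \<subseteq> ?B" and r_v: "\<And>i. i \<in> ?A \<Longrightarrow> r i \<le> v"
    using q by (auto simp: secures_swap_iff[OF G] r_def)
  have sums: "sum (pmf p) ?A = 1" "sum (pmf q) ?B = 1"
    using fin p_sub q_sub by (simp_all add: sum_pmf_eq_1)
  have "v = (\<Sum>j\<in>?B. pmf q j * v)"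
    by (simp add: sums flip: sum_distrib_right)
  also have "\<dots> \<le> (\<Sum>j\<in>?B. pmf q j * (\<Sum>i\<in>?A. pmf p i * ?u i j))"
    using p_v by (intro sum_mono mult_left_mono) auto
  also have "\<dots> = (\<Sum>i\<in>?A. pmf p i * r i)"
    unfolding r_def sum_distrib_left by (subst sum.swap) (simp add: mult_ac)
  finally have "(\<Sum>i\<in>?A. pmf p i * (v - r i)) \<le> 0"
    by (simp add: right_diff_distrib sum_subtractf sums flip: sum_distrib_right)
  moreover have "pmf p c * (v - r c) \<le> (\<Sum>i\<in>?A. pmf p i * (v - r i))"
    using c fin r_v by (intro member_le_sum) auto
  ultimately have "pmf p c * (v - r c) \<le> 0" by simp
  moreover have "pmf p c * (r d - v) \<le> 0"
    using r_v[OF d] by (simp add: mult_nonneg_nonpos)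
  moreover have "(\<Sum>j\<in>?B. pmf (pair_pmf p q) (c, j) * (?u d j - ?u c j)) = pmf p c * (r d - r c)"
    by (simp add: pmf_pair r_def right_diff_distrib sum_subtractf sum_distrib_left mult.assoc)
  ultimately show ?thesis
    by (simp add: right_diff_distrib)
qed

lemma optimal_product_ce:
  assumes G: "finite_game G" "zero_sum G"
    and p: "secures G v p" and q: "secures (swap_game G) (- v) q"
  shows "correlated_equilibrium G (pair_pmf p q)"
  unfolding correlated_equilibrium_def
proof (intro conjI ballI)
  show "set_pmf (pair_pmf p q) \<subseteq> strat1 G \<times> strat2 G"
    using p q by (auto simp: secures_def)
  show "(\<Sum>c2\<in>strat2 G. pmf (pair_pmf p q) (c1, c2) * (util1 G d1 c2 - util1 G c1 c2)) \<le> 0"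
    if "c1 \<in> strat1 G" "d1 \<in> strat1 G" for c1 d1
    using optimal_product_incentive[OF G p q that] .
  show "(\<Sum>c1\<in>strat1 G. pmf (pair_pmf p q) (c1, c2) * (util2 G c1 d2 - util2 G c1 c2)) \<le> 0"
    if "c2 \<in> strat2 G" "d2 \<in> strat2 G" for c2 d2
    using optimal_product_incentive[of "swap_game G" "- v" q p c2 d2] that G p q
    by (simp add: pmf_pair mult.commute[of "pmf q _"])
qed

lemma ce_strategies1_eq:
  assumes G: "finite_game G" "zero_sum G"
    and p: "secures G v p" and q: "secures (swap_game G) (- v) q"
  shows "ce_strategies1 G = (\<Union>p'\<in>{p'. secures G v p'}. set_pmf p')"
proof (intro equalityI subsetI)
  fix c assume "c \<in> ce_strategies1 G"
  then obtain \<mu> where "correlated_equilibrium G \<mu>" "c \<in> set_pmf (map_pmf fst \<mu>)"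
    unfolding ce_strategies1_def pmf_positive_iff by blast
  then show "c \<in> (\<Union>p'\<in>{p'. secures G v p'}. set_pmf p')"
    using ce_marginal_secures[OF G p] by blast
next
  fix c assume "c \<in> (\<Union>p'\<in>{p'. secures G v p'}. set_pmf p')"
  then obtain p' where p': "secures G v p'" "c \<in> set_pmf p'" by auto
  then have "c \<in> strat1 G" "pmf (map_pmf fst (pair_pmf p' q)) c > 0"
    by (auto simp: secures_def map_fst_pair_pmf pmf_positive_iff)
  then show "c \<in> ce_strategies1 G"
    using optimal_product_ce[OF G p'(1) q] unfolding ce_strategies1_def by blast
qed

section \<open>Absorbing sets of full dual vectors\<close>

lemma constant_dual_vector:
  assumes "zero_sum G" and p: "secures G v p" and q: "secures (swap_game G) (- v) q"
  shows "dual_vector G (\<lambda>_. p) (\<lambda>_. q)"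
  unfolding dual_vector_def deviation_plan_def
proof (intro conjI ballI)
  fix c1 c2 assume c: "c1 \<in> strat1 G" "c2 \<in> strat2 G"
  have "v \<le> mixed_util (util1 G) p (return_pmf c2)"
    using p c by (simp add: secures_def)
  moreover have "- v \<le> mixed_util (util2 G) (return_pmf c1) q"
    using q c by (auto simp: secures_def mixed_util_return_left mixed_util_return_right)
  moreover have "util1 G c1 c2 + util2 G c1 c2 = 0"
    using assms(1) c by (simp add: zero_sum_def)
  ultimately show "0 \<le> mixed_util (util1 G) p (return_pmf c2) - util1 G c1 c2 +
      (mixed_util (util2 G) (return_pmf c1) q - util2 G c1 c2)"
    by simp
qed (use p q in \<open>simp_all add: secures_def\<close>)

text \<open>
  In a zero-sum game the dual vector inequality reads \<open>U1(\<alpha>1 * i, c2) \<ge> U1(i, \<alpha>2 * c2)\<close>.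
  Averaging over \<open>p\<close> bounds the payoff of the image of \<open>p\<close> against \<open>c2\<close> from below by the payoff
  of \<open>p\<close> against the mixed strategy \<open>\<alpha>2 * c2\<close>, which is at least \<open>v\<close>.
\<close>

lemma secures_bind_dual:
  assumes G: "finite_game G" "zero_sum G" and dual: "dual_vector G \<alpha>1 \<alpha>2" and p: "secures G v p"
  shows "secures G v (bind_pmf p \<alpha>1)"
  unfolding secures_def
proof (intro conjI ballI)
  let ?A = "strat1 G" and ?B = "strat2 G" and ?u = "util1 G"
  have fin: "finite ?A" "finite ?B"
    using G by (auto simp: finite_game_def)
  have p_sub: "set_pmf p \<subseteq> ?A" and p_v: "\<And>j. j \<in> ?B \<Longrightarrow> v \<le> (\<Sum>i\<in>?A. pmf p i * ?u i j)"
    using p by (auto simp: secures_iff[OF G(1)])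
  have sub: "\<And>i. i \<in> ?A \<Longrightarrow> set_pmf (\<alpha>1 i) \<subseteq> ?A" "\<And>j. j \<in> ?B \<Longrightarrow> set_pmf (\<alpha>2 j) \<subseteq> ?B"
    using dual by (auto simp: dual_vector_def deviation_plan_def)
  show "set_pmf (bind_pmf p \<alpha>1) \<subseteq> ?A"
    using p_sub sub by auto
  fix c2 assume c2: "c2 \<in> ?B"
  have a2_sum: "sum (pmf (\<alpha>2 c2)) ?B = 1"
    using fin sub c2 by (simp add: sum_pmf_eq_1)
  have step: "(\<Sum>j\<in>?B. pmf (\<alpha>2 c2) j * ?u i j) \<le> mixed_util ?u (\<alpha>1 i) (return_pmf c2)"
    if i: "i \<in> ?A" for i
  proof -
    have "mixed_util (util2 G) (return_pmf i) (\<alpha>2 c2) = (\<Sum>j\<in>?B. pmf (\<alpha>2 c2) j * util2 G i j)"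
      using fin sub c2 by (simp add: mixed_util_return_left expectation_pmf_sum)
    also have "\<dots> = (\<Sum>j\<in>?B. - (pmf (\<alpha>2 c2) j * ?u i j))"
      using G(2) i by (intro sum.cong) (auto simp: zero_sum_util2)
    finally have "mixed_util (util2 G) (return_pmf i) (\<alpha>2 c2) = - (\<Sum>j\<in>?B. pmf (\<alpha>2 c2) j * ?u i j)"
      by (simp add: sum_negf)
    moreover have "0 \<le> mixed_util ?u (\<alpha>1 i) (return_pmf c2) - ?u i c2 +
        (mixed_util (util2 G) (return_pmf i) (\<alpha>2 c2) - util2 G i c2)"
      using dual i c2 by (simp add: dual_vector_def)
    moreover have "?u i c2 + util2 G i c2 = 0"
      using G(2) i c2 by (simp add: zero_sum_def)
    ultimately show ?thesis by simp
  qed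
  have "v = (\<Sum>j\<in>?B. pmf (\<alpha>2 c2) j * v)"
    by (simp add: a2_sum flip: sum_distrib_right)
  also have "\<dots> \<le> (\<Sum>j\<in>?B. pmf (\<alpha>2 c2) j * (\<Sum>i\<in>?A. pmf p i * ?u i j))"
    using p_v by (intro sum_mono mult_left_mono) auto
  also have "\<dots> = (\<Sum>i\<in>?A. pmf p i * (\<Sum>j\<in>?B. pmf (\<alpha>2 c2) j * ?u i j))"
    unfolding sum_distrib_left by (subst sum.swap) (simp add: mult_ac)
  also have "\<dots> \<le> (\<Sum>i\<in>?A. pmf p i * mixed_util ?u (\<alpha>1 i) (return_pmf c2))"
    using step by (intro sum_mono mult_left_mono) auto
  also have "\<dots> = mixed_util ?u (bind_pmf p \<alpha>1) (return_pmf c2)"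
    unfolding mixed_util_return_right
    using fin sub p_sub by (subst pmf_expectation_bind[of ?A]) (auto intro: finite_subset)
  finally show "v \<le> mixed_util ?u (bind_pmf p \<alpha>1) (return_pmf c2)" .
qed

text \<open>
  The set is absorbing because dual vectors preserve optimality.  It is contained in every other
  absorbing set because fullness, compared with the constant plans onto optimal strategies, makes
  each of its elements reachable in one step from anywhere.
\<close>

lemma full_dual_absorbing_ce_strategies1:
  assumes G: "finite_game G" "zero_sum G" and full: "full_dual_vector G \<alpha>1 \<alpha>2"
  shows "absorbing (strat1 G) \<alpha>1 (ce_strategies1 G)"
    and "absorbing (strat1 G) \<alpha>1 B \<Longrightarrow> ce_strategies1 G \<subseteq> B"
proof -
  obtain v p q where p: "secures G v p" and q: "secures (swap_game G) (- v) q"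
    using game_value_exists[OF G] .
  note S = ce_strategies1_eq[OF G p q]
  have dual: "dual_vector G \<alpha>1 \<alpha>2"
    using full by (simp add: full_dual_vector_def)
  show "absorbing (strat1 G) \<alpha>1 (ce_strategies1 G)"
    unfolding absorbing_def
  proof (intro conjI ballI)
    show "ce_strategies1 G \<noteq> {}"
      using p set_pmf_not_empty[of p] by (auto simp: S)
    show "ce_strategies1 G \<subseteq> strat1 G"
      by (auto simp: ce_strategies1_def)
    fix c assume "c \<in> ce_strategies1 G"
    then obtain p' where p': "secures G v p'" "c \<in> set_pmf p'" by (auto simp: S)
    have "set_pmf (\<alpha>1 c) \<subseteq> set_pmf (bind_pmf p' \<alpha>1)"
      using p'(2) by auto
    with secures_bind_dual[OF G dual p'(1)] show "set_pmf (\<alpha>1 c) \<subseteq> ce_strategies1 G"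
      unfolding S by blast
  qed
  assume B: "absorbing (strat1 G) \<alpha>1 B"
  show "ce_strategies1 G \<subseteq> B"
  proof
    fix d assume d: "d \<in> ce_strategies1 G"
    then obtain p' where p': "secures G v p'" "d \<in> set_pmf p'" by (auto simp: S)
    obtain c where c: "c \<in> B" "c \<in> strat1 G"
      using B by (auto simp: absorbing_def)
    have "d \<in> strat1 G"
      using d by (auto simp: ce_strategies1_def)
    then have "d \<in> set_pmf (\<alpha>1 c)"
      using full constant_dual_vector[OF G(2) p'(1) q] p'(2) c(2)
      unfolding full_dual_vector_def pmf_positive_iff by blast
    then show "d \<in> B"
      using B c(1) by (auto simp: absorbing_def)
  qed
qed

lemma full_dual_reduction_player1:
  assumes G: "finite_game G" "zero_sum G" and full: "full_dual_vector G \<alpha>1 \<alpha>2"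
  shows "grouped_together (strat1 G) \<alpha>1 (ce_strategies1 G)"
    and "c \<notin> ce_strategies1 G \<Longrightarrow> eliminated (strat1 (dual_reduction G \<alpha>1 \<alpha>2)) c"
proof -
  note abs = full_dual_absorbing_ce_strategies1[OF G full]
  have "minimal_absorbing (strat1 G) \<alpha>1 (ce_strategies1 G)"
    unfolding minimal_absorbing_def using abs by blast
  then show "grouped_together (strat1 G) \<alpha>1 (ce_strategies1 G)"
    unfolding grouped_together_def by blast
  have "B = ce_strategies1 G" if "minimal_absorbing (strat1 G) \<alpha>1 B" for B
    using that abs unfolding minimal_absorbing_def by blast
  then have "set_pmf \<sigma> \<subseteq> ce_strategies1 G" if "\<sigma> \<in> reduced_strategies (strat1 G) \<alpha>1" for \<sigma>
    using that unfolding reduced_strategies_def by blast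
  moreover assume "c \<notin> ce_strategies1 G"
  ultimately show "eliminated (strat1 (dual_reduction G \<alpha>1 \<alpha>2)) c"
    by (simp add: eliminated_def dual_reduction_def) (meson pmf_eq_0_set_pmf subsetD)
qed

theorem proposition18:
  fixes G :: "('a, 'b) game"
    and \<alpha>1 :: "'a \<Rightarrow> 'a pmf" and \<alpha>2 :: "'b \<Rightarrow> 'b pmf"
  assumes "finite_game G" and "zero_sum G"
    and "full_dual_vector G \<alpha>1 \<alpha>2"
  shows "grouped_together (strat1 G) \<alpha>1 (ce_strategies1 G) \<and>
         (\<forall>c \<in> strat1 G - ce_strategies1 G. eliminated (strat1 (dual_reduction G \<alpha>1 \<alpha>2)) c) \<and>
         grouped_together (strat2 G) \<alpha>2 (ce_strategies2 G) \<and>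
         (\<forall>c \<in> strat2 G - ce_strategies2 G. eliminated (strat2 (dual_reduction G \<alpha>1 \<alpha>2)) c)"
proof -
  have swap: "strat1 (dual_reduction (swap_game G) \<alpha>2 \<alpha>1) = strat2 (dual_reduction G \<alpha>1 \<alpha>2)"
    by (simp add: dual_reduction_def)
  show ?thesis
    using full_dual_reduction_player1[OF assms]
      full_dual_reduction_player1[of "swap_game G" \<alpha>2 \<alpha>1] assms
    by (simp add: full_dual_vector_swap ce_strategies1_swap swap)
qed

end
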